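(* For every integer $s\ge 3$, one has $$\Pi_{T_s+3}=\{(2,0),(1,1),(0,2)\},$$ and $$|M^{(2,0)}_{T_s+3}|=1,\qquad |M^{(1,1)}_{T_s+3}|=4,\qquad |M^{(0,2)}_{T_s+3}|=1.$$ Hence $|M_{T_s+3}|=6$ and $m^{\mathrm{sc}}_{T_s+3}=0$.
   Context: For an integer $m\ge 0$, $T_m:=m(m+1)/2$. Compressed form: a partition $\lambda$ is written $\lambda=(L_1^{m_1},\dots,L_r^{m_r})$ with $L_1>\cdots>L_r>0$ its distinct part sizes and $m_i\ge 1$ the multiplicity of $L_i$. Gaps: $g_i=L_i-L_{i+1}$ for $1\le i<r$ and $g_r=L_r$. Set $A(\lambda):=\#\{i:g_i>1\}$ and $B(\lambda):=\#\{i:m_i>1\}$. Partition graph: for $n\ge 1$, $G_n$ is the simple graph whose vertices are the integer partitions of $n$; two distinct partitions are adjacent if one is obtained from the other by an elementary transfer of one unit from one part to another (subtract $1$ from one part and add $1$ to another part), followed by reordering. Here the receiving part may be a zero part (so a new part $1$ may be created), and parts that become $0$ are discarded. $\deg(\lambda)$ is the degree of $\lambda$ in $G_n$, $\Delta_n:=\max_{\lambda\vdash n}\deg(\lambda)$, $M_n:=\{\lambda\vdash n:\deg(\lambda)=\Delta_n\}$, $\Pi_n:=\{(A(\lambda),B(\lambda)):\lambda\in M_n\}$, $M_n^{(a,b)}:=\{\lambda\in M_n:(A(\lambda),B(\lambda))=(a,b)\}$, and $m_n^{\mathrm{sc}}:=|\{\lambda\in M_n:\lambda=\lambda'\}|$,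 where $\lambda'$ is the conjugate partition. *)

theory Defs
  imports "HOL-Library.Multiset"
begin

definition tri :: "nat \<Rightarrow> nat" where
  "tri m = m * (m + 1) div 2"


section \<open>Integer partitions\<close>

text \<open>An integer partition is the finite multiset of its (positive) parts. In the compressed form
  \<open>(L\<^sub>1^m\<^sub>1, \<dots>, L\<^sub>r^m\<^sub>r)\<close> the distinct part sizes \<open>L\<^sub>i\<close> are the elements of
  \<^term>\<open>set_mset p\<close>, and the multiplicity of \<open>L\<^sub>i\<close> is \<open>count p L\<^sub>i\<close>.\<close>

definition partitions :: "nat \<Rightarrow> nat multiset set" where
  "partitions n = {p. (\<forall>x \<in># p. 0 < x) \<and> sum_mset p = n}"

text \<open>The gap below a part size \<open>L\<^sub>i\<close>: the difference to the next smaller part size \<open>L\<^bsub>i+1\<^esub>\<close>,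
  or \<open>L\<^sub>i\<close> itself if it is the smallest one (hence the inserted \<open>0\<close>).\<close>

definition gap :: "nat multiset \<Rightarrow> nat \<Rightarrow> nat" where
  "gap p x = x - Max (insert 0 {y \<in> set_mset p. y < x})"

definition A_stat :: "nat multiset \<Rightarrow> nat" where
  "A_stat p = card {x \<in> set_mset p. gap p x > 1}"

definition B_stat :: "nat multiset \<Rightarrow> nat" where
  "B_stat p = card {x \<in> set_mset p. count p x > 1}"

text \<open>The parts of the conjugate are the column lengths of the Young diagram: for each \<open>j\<close> between
  \<open>1\<close> and the largest part, the number of parts that are at least \<open>j\<close>.\<close>

definition conjugate :: "nat multiset \<Rightarrow> nat multiset" where
  "conjugate p = image_mset (\<lambda>j. size {#x \<in># p. j \<le> x#})
                            (mset_set {j. 1 \<le> j \<and> (\<exists>x \<in># p. j \<le> x)})"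


section \<open>The partition graph\<close>

text \<open>One unit moves from a part \<open>a\<close> to another part \<open>b\<close>, where \<open>b = 0\<close> is allowed.
  Removing \<open>a\<close> from \<open>p\<close> first ensures that \<open>b\<close> is a different part (possibly of the same size).
  For \<open>b = 0\<close>, subtracting \<open>{#a, b#}\<close> just removes \<open>a\<close>, since a partition has no part \<open>0\<close>. The
  filter discards \<open>a - 1\<close> when it is \<open>0\<close>.\<close>

definition transfer :: "nat multiset \<Rightarrow> nat multiset \<Rightarrow> bool" where
  "transfer p q \<longleftrightarrow>
     (\<exists>a b. a \<in># p \<and> (b = 0 \<or> b \<in># p - {#a#}) \<and>
            q = {#x \<in># (p - {#a, b#}) + {#a - 1, b + 1#}. 0 < x#})"

definition adjacent :: "nat \<Rightarrow> nat multiset \<Rightarrow> nat multiset \<Rightarrow> bool" where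
  "adjacent n p q \<longleftrightarrow>
     p \<in> partitions n \<and> q \<in> partitions n \<and> p \<noteq> q \<and> (transfer p q \<or> transfer q p)"

definition deg :: "nat \<Rightarrow> nat multiset \<Rightarrow> nat" where
  "deg n p = card {q. adjacent n p q}"

definition max_deg :: "nat \<Rightarrow> nat" where
  "max_deg n = Max (deg n ` partitions n)"

definition maximizers :: "nat \<Rightarrow> nat multiset set" where
  "maximizers n = {p \<in> partitions n. deg n p = max_deg n}"

definition types :: "nat \<Rightarrow> (nat \<times> nat) set" where
  "types n = (\<lambda>p. (A_stat p, B_stat p)) ` maximizers n"

definition maximizers_of_type :: "nat \<Rightarrow> nat \<times> nat \<Rightarrow> nat multiset set" where
  "maximizers_of_type n t = {p \<in> maximizers n. (A_stat p, B_stat p) = t}"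

definition num_selfconj_maximizers :: "nat \<Rightarrow> nat" where
  "num_selfconj_maximizers n = card {p \<in> maximizers n. p = conjugate p}"

text \<open>The sets whose \<^const>\<open>card\<close> or \<^const>\<open>Max\<close> is taken above are finite, so these have their
  intended meaning.\<close>

lemma size_le_sum_mset:
  fixes p :: "nat multiset"
  assumes "\<forall>x \<in># p. 0 < x"
  shows "size p \<le> sum_mset p"
  using assms by (induction p) auto

lemma finite_partitions: "finite (partitions n)"
proof (rule finite_subset)
  show "partitions n \<subseteq> mset ` {xs. set xs \<subseteq> {..n} \<and> length xs \<le> n}"
  proof
    fix p assume p: "p \<in> partitions n"
    obtain xs where xs: "p = mset xs" by (metis ex_mset)
    have "x \<le> n" if "x \<in># p" for x
      using p multi_member_split[OF that] by (auto simp: partitions_def)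
    moreover have "size p \<le> n"
      using p size_le_sum_mset[of p] by (auto simp: partitions_def)
    ultimately show "p \<in> mset ` {xs. set xs \<subseteq> {..n} \<and> length xs \<le> n}"
      using xs by auto
  qed
  show "finite (mset ` {xs. set xs \<subseteq> {..n} \<and> length xs \<le> n})"
    by (intro finite_imageI finite_lists_length_le) simp
qed

lemma finite_neighbours: "finite {q. adjacent n p q}"
  by (rule finite_subset[OF _ finite_partitions[of n]]) (auto simp: adjacent_def)

lemma finite_conjugate_index: "finite {j::nat. 1 \<le> j \<and> (\<exists>x \<in># p. j \<le> x)}"
proof (rule finite_subset)
  show "{j. 1 \<le> j \<and> (\<exists>x \<in># p. j \<le> x)} \<subseteq> (\<Union>x \<in> set_mset p. {..x})" by auto
qed simp

end

(* Moving a box from a part of size a to a part of size b changes only the column lengths at a and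
   b + 1, so nontrivial moves (b \<noteq> a - 1) give pairwise different neighbours. Counting the pairs (a, b)
   gives deg p = r * (r - 1) + A + B, where r is the number of distinct part sizes. As A, B \<le> r, fewer
   than s distinct sizes give degree at most s * (s - 1). If r = s, removing one copy of each part
   size leaves an excess of at most 3 to distribute over the staircase {1..s} and the repeated parts;
   of the ten possibilities, six have A + B = 2 and the others have A + B = 1. *)

theory Submission
  imports Defs
begin

section \<open>Gaps as missing predecessors\<close>

text \<open>Trades the \<open>Max\<close> inside \<open>gap\<close> for a membership test. The
  condition \<open>1 < x\<close> handles the size 1, whose gap to the inserted 0 is never more than
  1.\<close>

lemma A_stat_eq: "A_stat p = card {x \<in> set_mset p. 1 < x \<and> x - 1 \<notin># p}"
proof -
  have "gap p x > 1 \<longleftrightarrow> 1 < x \<and> x - 1 \<notin># p" for x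
  proof -
    define m where "m = Max (insert 0 {y \<in> set_mset p. y < x})"
    have "m \<in> insert 0 {y \<in> set_mset p. y < x}" unfolding m_def by (intro Max_in) auto
    then have m: "m = 0 \<or> m \<in># p \<and> m < x" by blast
    have m_ge: "y \<le> m" if "y \<in># p" "y < x" for y unfolding m_def using that by (intro Max_ge) auto
    show ?thesis
    proof
      assume "gap p x > 1"
      then have "m + 1 < x" by (auto simp: gap_def m_def)
      with m_ge[of "x - 1"] show "1 < x \<and> x - 1 \<notin># p" by linarith
    next
      assume x: "1 < x \<and> x - 1 \<notin># p"
      then have "m \<noteq> x - 1" using m by (metis less_numeral_extra(3) zero_less_diff)
      with m x have "m + 1 < x" by linarith
      then show "gap p x > 1" by (auto simp: gap_def m_def)
    qed
  qed
  then show ?thesis by (simp add: A_stat_def)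
qed

section \<open>The degree formula\<close>

text \<open>The functional form of \<open>transfer\<close>, indexed by pairs of sizes, so that
  neighbours can be counted as images of pairs.\<close>

definition move :: "nat multiset \<Rightarrow> nat \<times> nat \<Rightarrow> nat multiset" where
  "move p = (\<lambda>(a, b). {#x \<in># (p - {#a, b#}) + {#a - 1, b + 1#}. 0 < x#})"

definition moves :: "nat multiset \<Rightarrow> (nat \<times> nat) set" where
  "moves p = {(a, b). a \<in># p \<and> (b = 0 \<or> b \<in># p - {#a#})}"

lemma transfer_iff: "transfer p q \<longleftrightarrow> (\<exists>m \<in> moves p. q = move p m)"
  by (auto simp: transfer_def moves_def move_def)

text \<open>Normal form of a move: the untouched rest \<open>r\<close> contains no 0, so the filter
  acts on the two new parts alone and the multiset difference disappears.\<close>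

lemma moves_cases:
  assumes "(a, b) \<in> moves p" "0 \<notin># p"
  obtains (zero) r where "b = 0" "p = add_mset a r" "0 < a" "0 \<notin># r"
      "move p (a, b) = {#x \<in># {#a - 1, 1#}. 0 < x#} + r"
    | (pos) r where "0 < b" "p = add_mset a (add_mset b r)" "0 < a" "0 \<notin># r"
      "move p (a, b) = {#x \<in># {#a - 1, b + 1#}. 0 < x#} + r"
proof (cases "b = 0")
  case True
  from assms obtain r where r: "p = add_mset a r" by (auto simp: moves_def dest: multi_member_split)
  have "filter_mset ((<) 0) r = r" using assms r by (auto simp: filter_mset_eq_conv intro: gr0I)
  moreover have "r - {#0#} = r" using assms r by (auto intro: diff_single_trivial)
  ultimately show ?thesis using True r assms by (intro zero[of r]) (auto simp: move_def intro: gr0I)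
next
  case False
  with assms have "a \<in># p" "b \<in># p - {#a#}" by (auto simp: moves_def)
  then obtain r where r: "p = add_mset a (add_mset b r)"
    by (metis insert_DiffM)
  have "filter_mset ((<) 0) r = r" using assms r by (auto simp: filter_mset_eq_conv intro: gr0I)
  then show ?thesis using False r assms by (intro pos[of r]) (auto simp: move_def intro: gr0I)
qed

lemma sum_mset_move:
  assumes "m \<in> moves p" "0 \<notin># p"
  shows "sum_mset (move p m) = sum_mset p"
proof -
  obtain a b where m: "m = (a, b)" by force
  show ?thesis using assms unfolding m by (cases rule: moves_cases) auto
qed

text \<open>In terms of the column lengths, a move takes a box from column \<open>a\<close> and adds one to
  column \<open>b + 1\<close>.\<close>

lemma columns_move:
  assumes "(a, b) \<in> moves p" "0 \<notin># p" "0 < t"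
  shows "size {#x \<in># move p (a, b). t \<le> x#} + (if t = a then 1 else 0)
       = size {#x \<in># p. t \<le> x#} + (if t = b + 1 then 1 else 0)"
  using assms(1,2)
proof (cases rule: moves_cases)
  case (zero r)
  then show ?thesis unfolding zero(5) using assms(3) by auto
next
  case (pos r)
  then show ?thesis unfolding pos(5) using assms(3) by auto
qed

text \<open>If nothing changes, the box taken from column \<open>a\<close> must return to it, so
  \<open>b + 1 = a\<close>. Conversely, such a move merely exchanges the sizes \<open>a\<close> and
  \<open>a - 1\<close>.\<close>

lemma move_trivial_iff:
  assumes "(a, b) \<in> moves p" "0 \<notin># p"
  shows "move p (a, b) = p \<longleftrightarrow> b = a - 1"
proof
  have a: "0 < a" using assms by (auto simp: moves_def intro: gr0I)
  assume eq: "move p (a, b) = p"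
  have "(if a = a then 1 else 0) = (if a = b + 1 then 1 else 0 :: nat)"
    by (rule add_left_imp_eq) (rule columns_move[OF assms a, unfolded eq])
  then have "a = b + 1" by (metis zero_neq_one)
  then show "b = a - 1" by simp
next
  assume b: "b = a - 1"
  from assms show "move p (a, b) = p"
  proof (cases rule: moves_cases)
    case (zero r)
    then have "a = 1" using b by simp
    then show ?thesis unfolding zero(5) using zero(2) by simp
  next
    case (pos r)
    then have "b + 1 = a" using b by simp
    then show ?thesis unfolding pos(5) using pos(1,2,3) b by (simp add: add_mset_commute)
  qed
qed

text \<open>For a nontrivial move, column \<open>a\<close> is the only one that shrinks and column
  \<open>b + 1\<close> the only one that grows, so the result determines both.\<close>

lemma inj_on_move:
  assumes "0 \<notin># p"
  shows "inj_on (move p) {(a, b) \<in> moves p. b \<noteq> a - 1}"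
proof (rule inj_onI, clarify)
  fix a b c d
  assume ab: "(a, b) \<in> moves p" "b \<noteq> a - 1" and cd: "(c, d) \<in> moves p" "d \<noteq> c - 1"
    and eq: "move p (a, b) = move p (c, d)"
  have pos: "0 < a" "0 < c" using assms ab cd by (auto simp: moves_def intro: gr0I)
  note * = columns_move[OF ab(1) assms, unfolded eq] columns_move[OF cd(1) assms]
  from *[of a] pos ab cd have "a = c" by (auto split: if_splits)
  moreover from *[of "b + 1"] pos ab cd have "b = d" by (auto split: if_splits)
  ultimately show "a = c \<and> b = d" by simp
qed

text \<open>The move \<open>(b + 1, a - 1)\<close> undoes \<open>(a, b)\<close>; for
  \<open>a = 1\<close> its receiver is the zero part.\<close>

lemma transfer_sym:
  assumes "transfer p q" "0 \<notin># p"
  shows "transfer q p"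
proof -
  from assms(1) obtain a b where ab: "(a, b) \<in> moves p" and q: "q = move p (a, b)"
    by (auto simp: transfer_iff)
  have mem: "(b + 1, a - 1) \<in> moves q" using ab assms(2) unfolding q
    by (cases rule: moves_cases) (auto simp: moves_def)
  have "p = move q (b + 1, a - 1)" using ab assms(2)
  proof (cases rule: moves_cases)
    case (zero r)
    have "filter_mset ((<) 0) r = r" using zero by (auto simp: filter_mset_eq_conv intro: gr0I)
    moreover have "r - {#0#} = r" using zero by (auto intro: diff_single_trivial)
    ultimately show ?thesis using zero by (auto simp: q move_def)
  next
    case (pos r)
    have "filter_mset ((<) 0) r = r" using pos by (auto simp: filter_mset_eq_conv intro: gr0I)
    moreover have "r - {#0#} = r" using pos by (auto intro: diff_single_trivial)
    ultimately show ?thesis using pos by (auto simp: q move_def)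
  qed
  with mem show ?thesis by (auto simp: transfer_iff)
qed

lemma zero_notin_partitions: "p \<in> partitions n \<Longrightarrow> 0 \<notin># p"
  by (auto simp: partitions_def)

lemma neighbours_eq:
  assumes p: "p \<in> partitions n"
  shows "{q. adjacent n p q} = move p ` {(a, b) \<in> moves p. b \<noteq> a - 1}"
proof -
  note p0 = zero_notin_partitions[OF p]
  have "adjacent n p q \<longleftrightarrow> transfer p q \<and> p \<noteq> q" for q
  proof
    assume "adjacent n p q"
    then show "transfer p q \<and> p \<noteq> q"
      using transfer_sym[of q p] zero_notin_partitions by (auto simp: adjacent_def)
  next
    assume *: "transfer p q \<and> p \<noteq> q"
    then obtain m where m: "m \<in> moves p" "q = move p m" by (auto simp: transfer_iff)
    then have "q \<in> partitions n"
      using p sum_mset_move[OF m(1) p0] by (simp add: partitions_def move_def case_prod_unfold del: filter_union_mset filter_mset_add_mset)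
    with * p show "adjacent n p q" by (auto simp: adjacent_def)
  qed
  moreover have "p \<noteq> move p (a, b) \<longleftrightarrow> b \<noteq> a - 1" if "(a, b) \<in> moves p" for a b
    using move_trivial_iff[OF that p0] by metis
  ultimately show ?thesis unfolding transfer_iff by (fastforce simp: image_iff)
qed

lemma deg_add_distinct_parts:
  assumes p: "p \<in> partitions n"
  defines "r \<equiv> card (set_mset p)"
  shows "deg n p + r = r * r + A_stat p + B_stat p"
proof -
  note p0 = zero_notin_partitions[OF p]
  let ?D = "set_mset p"
  let ?A = "{x \<in> ?D. 1 < x \<and> x - 1 \<notin># p}" and ?B = "{x \<in> ?D. count p x > 1}"
  let ?M = "{(a, b) \<in> moves p. b \<noteq> a - 1}"
  \<comment> \<open>Of the r * (r + 1) pairs in \<open>?D \<times> insert 0 ?D\<close>, exactly two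
    kinds are not nontrivial moves: \<open>?S\<close>, where no second part of size \<open>a\<close>
    exists, and \<open>?T\<close>, where the move is trivial. They number r - B and r - A, which
    leaves r * (r - 1) + A + B.\<close>
  let ?S = "(\<lambda>a. (a, a)) ` (?D - ?B)" and ?T = "(\<lambda>a. (a, a - 1)) ` (?D - ?A)"
  have "a - 1 \<noteq> a" if "a \<in># p" for a using that p0 by (cases a) auto
  then have ST: "?S \<inter> ?T = {}" by force
  have mem: "b \<in># p - {#a#} \<longleftrightarrow> b \<in># p \<and> (b = a \<longrightarrow> count p a > 1)" for a b
    by (auto simp: in_diff_count intro: count_inI)
  have M: "(a, b) \<in> ?M \<longleftrightarrow> a \<in># p \<and> (b = 0 \<or> b \<in># p \<and> (b = a \<longrightarrow> count p a > 1)) \<and> b \<noteq> a - 1" for a b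
    by (simp add: moves_def mem)
  have S: "(a, b) \<in> ?S \<longleftrightarrow> a \<in># p \<and> b = a \<and> \<not> count p a > 1" for a b
    by auto
  have T: "(a, b) \<in> ?T \<longleftrightarrow> a \<in># p \<and> b = a - 1 \<and> (b = 0 \<or> b \<in># p)" for a b
    by fastforce
  have "?D \<times> insert 0 ?D = ?M \<union> (?S \<union> ?T)"
  proof (rule set_eqI)
    fix x :: "nat \<times> nat"
    obtain a b where x: "x = (a, b)" by force
    show "x \<in> ?D \<times> insert 0 ?D \<longleftrightarrow> x \<in> ?M \<union> (?S \<union> ?T)"
      unfolding x Un_iff M S T mem_Times_iff using p0 by auto
  qed
  moreover have "?M \<inter> (?S \<union> ?T) = {}"
  proof (rule equals0I)
    fix x assume "x \<in> ?M \<inter> (?S \<union> ?T)"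
    moreover obtain a b where "x = (a, b)" by force
    ultimately have "(a, b) \<in> ?M" "(a, b) \<in> ?S \<or> (a, b) \<in> ?T" by blast+
    then show False unfolding M S T using p0 by auto
  qed
  moreover have "finite ?M"
    by (rule finite_subset[of _ "?D \<times> insert 0 ?D"]) (auto simp: moves_def dest: in_diffD)
  ultimately have "card (?D \<times> insert 0 ?D) = card ?M + (card ?S + card ?T)"
    using ST by (simp add: card_Un_disjoint)
  moreover have "card ?S = r - B_stat p" "card ?T = r - A_stat p"
    unfolding A_stat_eq B_stat_def r_def
    by (subst card_image; auto simp: inj_on_def card_Diff_subset)+
  moreover have "A_stat p \<le> r" "B_stat p \<le> r"
    unfolding A_stat_eq B_stat_def r_def by (auto intro: card_mono)
  moreover have "deg n p = card ?M"
    unfolding deg_def neighbours_eq[OF p] by (rule card_image[OF inj_on_move[OF p0]])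
  moreover have "card (?D \<times> insert 0 ?D) = r * r + r"
    using p0 by (simp add: card_cartesian_product r_def)
  ultimately show ?thesis by linarith
qed

text \<open>Both statistics are at most r, and r * (r - 1) + 2 * r = r * (r + 1). This crude bound
  settles every r below s.\<close>

lemma deg_le:
  assumes "p \<in> partitions n"
  shows "deg n p \<le> card (set_mset p) * (card (set_mset p) + 1)"
proof -
  have "A_stat p \<le> card (set_mset p)" "B_stat p \<le> card (set_mset p)"
    unfolding A_stat_def B_stat_def by (auto intro: card_mono)
  with deg_add_distinct_parts[OF assms] show ?thesis by simp
qed

section \<open>Sets of positive integers with almost minimal sum\<close>

lemma tri_0 [simp]: "tri 0 = 0" and tri_Suc [simp]: "tri (Suc m) = tri m + Suc m"
  by (auto simp: tri_def)

lemma sum_Icc_eq_tri: "\<Sum>{1..m} = tri m"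
  by (induction m) auto

lemma tri_mono: "m \<le> n \<Longrightarrow> tri m \<le> tri n"
  by (induction n) (auto simp: le_Suc_eq)

lemma subset_Icc_Max: "finite D \<Longrightarrow> 0 \<notin> D \<Longrightarrow> D \<subseteq> {1..Max D}" for D :: "nat set"
  by (auto simp: Suc_le_eq intro: gr0I)

lemma card_le_Max: "finite D \<Longrightarrow> 0 \<notin> D \<Longrightarrow> card D \<le> Max D" for D :: "nat set"
  using card_mono[OF _ subset_Icc_Max[of D]] by simp

text \<open>Induction by removing the maximum, which is at least the cardinality because
  \<open>D\<close> lies in \<open>{1..Max D}\<close>.\<close>

lemma tri_card_le_sum:
  fixes D :: "nat set"
  assumes "finite D" "0 \<notin> D"
  shows "tri (card D) \<le> \<Sum>D"
  using assms
proof (induction "card D" arbitrary: D)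
  case 0
  then show ?case by simp
next
  case (Suc r)
  then have "Max D \<in> D" by (intro Max_in) auto
  with Suc.hyps(2) Suc.prems have "card (D - {Max D}) = r" "\<Sum>D = Max D + \<Sum>(D - {Max D})"
    by (auto simp: sum.remove)
  moreover have "Suc r \<le> Max D" using card_le_Max[of D] Suc by simp
  moreover have "tri (card (D - {Max D})) \<le> \<Sum>(D - {Max D})"
    using Suc calculation by (intro Suc.hyps(1)) auto
  ultimately show ?case using Suc.hyps(2) by (metis tri_Suc add.commute add_mono)
qed

text \<open>The recursion behind the classification: a maximum \<open>s + k\<close> with
  \<open>k > 0\<close> uses up \<open>k\<close> of the excess \<open>e\<close>, and the remaining
  \<open>s - 1\<close> elements have the smaller excess \<open>e - k\<close>.\<close>

lemma remove_Max_cases: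
  fixes D :: "nat set"
  assumes "finite D" "0 \<notin> D" "card D = s" "\<Sum>D = tri s + e"
  obtains (initial) "D = {1..s}" "e = 0"
    | (step) k D' where "0 < k" "k \<le> e" "0 < s" "D = insert (s + k) D'" "s + k \<notin> D'" "finite D'" "0 \<notin> D'"
        "card D' = s - 1" "\<Sum>D' = tri (s - 1) + (e - k)"
\<comment> \<open>\<open>Max {}\<close> is unspecified, so the empty set is named explicitly; it is
  the initial case with \<open>s = 0\<close>.\<close>
proof (cases "D = {} \<or> Max D = s")
  case True
  then have "D \<subseteq> {1..s}" using subset_Icc_Max[OF assms(1,2)] by auto
  then have D: "D = {1..s}" using assms(3) by (intro card_subset_eq) auto
  then have "e = 0" using assms(4) unfolding D sum_Icc_eq_tri by simp
  with D show ?thesis by (rule initial)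
next
  case False
  then have M: "Max D \<in> D" using assms(1) by (intro Max_in) auto
  define D' where "D' = D - {Max D}"
  define k where "k = Max D - s"
  have Max: "Max D = s + k" "0 < k" using card_le_Max[OF assms(1,2)] False assms(3) by (auto simp: k_def)
  have "0 < s" using M assms(1,3) by (auto simp: card_gt_0_iff)
  have card: "card D' = s - 1" and sum: "\<Sum>D = (s + k) + \<Sum>D'"
    using M assms(1,3) Max by (auto simp: D'_def sum.remove)
  have "tri s = tri (s - 1) + s" using \<open>0 < s\<close> by (cases s) auto
  moreover have "tri (s - 1) \<le> \<Sum>D'" using tri_card_le_sum[of D'] card assms by (auto simp: D'_def)
  ultimately have "k \<le> e" "\<Sum>D' = tri (s - 1) + (e - k)" using sum assms(4) by linarith+
  then show ?thesis using Max \<open>0 < s\<close> card assms M by (intro step[of k D']) (auto simp: D'_def)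
qed

lemma set_excess_0:
  fixes D :: "nat set"
  assumes "finite D" "0 \<notin> D" "card D = s" "\<Sum>D = tri s"
  shows "D = {1..s}"
  using assms remove_Max_cases[of D s 0] by force

lemma set_excess_1:
  fixes D :: "nat set"
  assumes "finite D" "0 \<notin> D" "card D = s" "\<Sum>D = tri s + 1"
  shows "D = insert (s + 1) {1..s - 1}"
  using assms
proof (cases rule: remove_Max_cases)
  case (step k D')
  then have "k = 1" by simp
  with step set_excess_0[of D' "s - 1"] show ?thesis by simp
qed simp

lemma set_excess_2:
  fixes D :: "nat set"
  assumes "finite D" "0 \<notin> D" "card D = s" "\<Sum>D = tri s + 2"
  shows "D = insert (s + 2) {1..s - 1} \<or> D = {s + 1, s} \<union> {1..s - 2}"
  using assms
proof (cases rule: remove_Max_cases)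
  case (step k D')
  then have "k = 1 \<or> k = 2" by auto
  with step set_excess_0[of D' "s - 1"] set_excess_1[of D' "s - 1"] show ?thesis by (auto simp: numeral_2_eq_2)
qed simp

text \<open>Subtracting the staircase from the sorted elements leaves a partition of 3; the
  alternatives are 3, 2 + 1 and 1 + 1 + 1, and \<open>k\<close> is the largest part.\<close>

lemma set_excess_3:
  fixes D :: "nat set"
  assumes "finite D" "0 \<notin> D" "card D = s" "\<Sum>D = tri s + 3"
  shows "D = insert (s + 3) {1..s - 1} \<or> D = {s + 2, s} \<union> {1..s - 2}
    \<or> D = {s + 1, s, s - 1} \<union> {1..s - 3}"
  using assms
proof (cases rule: remove_Max_cases)
  case (step k D')
  then consider "k = 1" | "k = 2" | "k = 3" by fastforce
  then show ?thesis
  proof cases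
    case 1
    then have "\<Sum>D' = tri (s - 1) + 2" using step by simp
    then have "D' = insert (s - 1 + 2) {1..s - 1 - 1} \<or> D' = {s - 1 + 1, s - 1} \<union> {1..s - 1 - 2}"
      using step by (intro set_excess_2) auto
    moreover have "s - 1 + 2 = s + 1" "s - 1 + 1 = s" "s - 1 - 2 = s - 3" using step by auto
    \<comment> \<open>The first alternative would contain \<open>s + 1\<close>, the maximum that was
      just removed.\<close>
    ultimately have "D' = {s, s - 1} \<union> {1..s - 3}" using step 1 by auto
    then show ?thesis using step 1 by auto
  next
    case 2
    with step set_excess_1[of D' "s - 1"] show ?thesis by (auto simp: numeral_2_eq_2)
  next
    case 3
    with step set_excess_0[of D' "s - 1"] show ?thesis by simp
  qed
qed simp

section \<open>Partitions with the maximal number of distinct parts\<close>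

lemma partitions_0: "0 \<notin># E \<Longrightarrow> sum_mset E = 0 \<Longrightarrow> E = {#}" for E :: "nat multiset"
  by (cases E) auto

lemma partitions_1: "0 \<notin># E \<Longrightarrow> sum_mset E = 1 \<Longrightarrow> E = {#1#}" for E :: "nat multiset"
  by (cases E) (auto simp: add_is_1 intro!: partitions_0)

lemma partitions_2:
  fixes E :: "nat multiset"
  assumes "0 \<notin># E" "sum_mset E = 2"
  shows "E = {#2#} \<or> E = {#1, 1#}"
proof (cases E)
  case (add x F)
  then have "x = 1 \<or> x = 2" using assms by auto
  then show ?thesis using assms add partitions_0[of F] partitions_1[of F] by auto
qed (use assms in simp)

lemma partitions_3:
  fixes E :: "nat multiset"
  assumes "0 \<notin># E" "sum_mset E = 3"
  shows "E = {#3#} \<or> E = {#1, 2#} \<or> E = {#1, 1, 1#}"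
proof (cases E)
  case (add x F)
  then consider "x = 1" | "x = 2" | "x = 3" using assms by fastforce
  then show ?thesis
    using assms add partitions_0[of F] partitions_1[of F] partitions_2[of F] by cases auto
qed (use assms in simp)


section \<open>Splitting a partition into its distinct sizes and an excess\<close>

lemma mset_set_add_excess:
  fixes p :: "nat multiset"
  obtains E where "p = mset_set (set_mset p) + E" "set_mset E \<subseteq> set_mset p"
proof
  have "mset_set (set_mset p) \<subseteq># p"
    by (rule mset_set_set_mset_msubset)
  then show "p = mset_set (set_mset p) + (p - mset_set (set_mset p))" by simp
  show "set_mset (p - mset_set (set_mset p)) \<subseteq> set_mset p" by (meson in_diffD subsetI)
qed

text \<open>The decomposition separates the statistics: A sees only the set \<open>D\<close> of
  sizes, whereas B sees only \<open>E\<close>, since a size is repeated exactly when it occurs in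
  \<open>E\<close>.\<close>

lemma A_stat_mset_set_add:
  assumes "finite D" "set_mset E \<subseteq> D"
  shows "A_stat (mset_set D + E) = card {x \<in> D. 1 < x \<and> x - 1 \<notin> D}"
proof -
  have "set_mset (mset_set D + E) = D" using assms by auto
  then show ?thesis by (simp only: A_stat_eq)
qed

lemma B_stat_mset_set_add:
  assumes "finite D" "set_mset E \<subseteq> D"
  shows "B_stat (mset_set D + E) = card (set_mset E)"
proof -
  have "{x \<in> set_mset (mset_set D + E). count (mset_set D + E) x > 1} = set_mset E"
    using assms by (auto simp: count_mset_set')
  then show ?thesis by (simp only: B_stat_def)
qed

text \<open>Removing one copy of every part size leaves an excess \<open>E\<close>; the sums of \<open>E\<close> and of the set of
  part sizes above \<open>tri s\<close> add up to 3.\<close>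

lemma partitions_max_distinct_parts:
  assumes s: "s \<ge> 3" and p: "p \<in> partitions (tri s + 3)" and card: "card (set_mset p) = s"
  obtains "p = mset_set {1..s} + {#3#}"
    | "p = mset_set {1..s} + {#1, 2#}"
    | "p = mset_set {1..s} + {#1, 1, 1#}"
    | "p = mset_set (insert (s + 1) {1..s - 1}) + {#2#}"
    | "p = mset_set (insert (s + 1) {1..s - 1}) + {#1, 1#}"
    | "p = mset_set (insert (s + 2) {1..s - 1}) + {#1#}"
    | "p = mset_set ({s + 1, s} \<union> {1..s - 2}) + {#1#}"
    | "p = mset_set (insert (s + 3) {1..s - 1})"
    | "p = mset_set ({s + 2, s} \<union> {1..s - 2})"
    | "p = mset_set ({s + 1, s, s - 1} \<union> {1..s - 3})"
proof -
  note p0 = zero_notin_partitions[OF p]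
  define D where "D = set_mset p"
  obtain E where E: "p = mset_set D + E" "set_mset E \<subseteq> D"
    unfolding D_def by (rule mset_set_add_excess)
  have D: "finite D" "0 \<notin> D" "card D = s" using p0 card by (simp_all add: D_def)
  have E0: "0 \<notin># E" using E(2) D by blast
  have "sum_mset p = tri s + 3" using p by (simp add: partitions_def)
  moreover have "sum_mset p = \<Sum>D + sum_mset E"
    by (subst E(1)) (simp add: sum_unfold_sum_mset)
  moreover have "tri s \<le> \<Sum>D" using tri_card_le_sum[of D] D by simp
  \<comment> \<open>Four ways to share the surplus 3 between \<open>D\<close> and \<open>E\<close>.
    Combining the possible \<open>D\<close> and \<open>E\<close> in each gives 3 + 2 + 2 + 3 = 10
    shapes.\<close>
  ultimately consider "\<Sum>D = tri s" "sum_mset E = 3" | "\<Sum>D = tri s + 1" "sum_mset E = 2"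
    | "\<Sum>D = tri s + 2" "sum_mset E = 1" | "\<Sum>D = tri s + 3" "sum_mset E = 0"
    by linarith
  then show thesis
  proof cases
    case 1
    then have "D = {1..s}" using set_excess_0[OF D] by simp
    then show ?thesis using partitions_3[OF E0 1(2)] E(1) that(1-3) by (elim disjE) simp_all
  next
    case 2
    then have "D = insert (s + 1) {1..s - 1}" using set_excess_1[OF D] by simp
    then show ?thesis using partitions_2[OF E0 2(2)] E(1) that(4,5) by (elim disjE) simp_all
  next
    case 3
    then have "p = mset_set D + {#1#}" using partitions_1[OF E0] E(1) by simp
    then show ?thesis using set_excess_2[OF D 3(1)] that(6,7) by (elim disjE) simp_all
  next
    case 4
    then have "p = mset_set D" using partitions_0[OF E0] E(1) by simp
    then show ?thesis using set_excess_3[OF D 4(1)] that(8-10) by (elim disjE) simp_all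
  qed
qed

lemma stats_max_distinct_parts:
  assumes "s \<ge> 3"
  shows "A_stat (mset_set {1..s} + {#3#}) = 0" "B_stat (mset_set {1..s} + {#3#}) = 1"
    "A_stat (mset_set {1..s} + {#1, 2#}) = 0" "B_stat (mset_set {1..s} + {#1, 2#}) = 2"
    "A_stat (mset_set {1..s} + {#1, 1, 1#}) = 0" "B_stat (mset_set {1..s} + {#1, 1, 1#}) = 1"
    "A_stat (mset_set (insert (s + 1) {1..s - 1}) + {#2#}) = 1"
    "B_stat (mset_set (insert (s + 1) {1..s - 1}) + {#2#}) = 1"
    "A_stat (mset_set (insert (s + 1) {1..s - 1}) + {#1, 1#}) = 1"
    "B_stat (mset_set (insert (s + 1) {1..s - 1}) + {#1, 1#}) = 1"
    "A_stat (mset_set (insert (s + 2) {1..s - 1}) + {#1#}) = 1"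
    "B_stat (mset_set (insert (s + 2) {1..s - 1}) + {#1#}) = 1"
    "A_stat (mset_set ({s + 1, s} \<union> {1..s - 2}) + {#1#}) = 1"
    "B_stat (mset_set ({s + 1, s} \<union> {1..s - 2}) + {#1#}) = 1"
    "A_stat (mset_set (insert (s + 3) {1..s - 1})) = 1"
    "B_stat (mset_set (insert (s + 3) {1..s - 1})) = 0"
    "A_stat (mset_set ({s + 2, s} \<union> {1..s - 2})) = 2"
    "B_stat (mset_set ({s + 2, s} \<union> {1..s - 2})) = 0"
    "A_stat (mset_set ({s + 1, s, s - 1} \<union> {1..s - 3})) = 1"
    "B_stat (mset_set ({s + 1, s, s - 1} \<union> {1..s - 3})) = 0"
proof -
  \<comment> \<open>For each shape of \<open>D\<close>, the sizes directly above a hole. In the last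
    one, \<open>s \<ge> 3\<close> makes \<open>s - 2\<close> a genuine missing size, so that
    \<open>s - 1\<close> is counted.\<close>
  have 1: "{x \<in> {1..s}. 1 < x \<and> x - 1 \<notin> {1..s}} = {}" by auto
  have 2: "{x \<in> insert (s + k) {1..s - 1}. 1 < x \<and> x - 1 \<notin> insert (s + k) {1..s - 1}} = {s + k}"
    if "0 < k" for k
    using assms that by auto
  have 3: "{x \<in> {s + 1, s} \<union> {1..s - 2}. 1 < x \<and> x - 1 \<notin> {s + 1, s} \<union> {1..s - 2}} = {s}"
    using assms by auto
  have 4: "{x \<in> {s + 2, s} \<union> {1..s - 2}. 1 < x \<and> x - 1 \<notin> {s + 2, s} \<union> {1..s - 2}} = {s + 2, s}"
    using assms by auto
  have 5: "{x \<in> {s + 1, s, s - 1} \<union> {1..s - 3}. 1 < x \<and> x - 1 \<notin> {s + 1, s, s - 1} \<union> {1..s - 3}} = {s - 1}"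
    using assms by auto
  \<comment> \<open>The last three shapes have no repeated part; here \<open>E = {#}\<close> and the
    sum is dropped.\<close>
  note empty = A_stat_mset_set_add[where E = "{#}", unfolded add_0_right] B_stat_mset_set_add[where E = "{#}", unfolded add_0_right]
  show "A_stat (mset_set {1..s} + {#3#}) = 0" "B_stat (mset_set {1..s} + {#3#}) = 1"
    "A_stat (mset_set {1..s} + {#1, 2#}) = 0" "B_stat (mset_set {1..s} + {#1, 2#}) = 2"
    "A_stat (mset_set {1..s} + {#1, 1, 1#}) = 0" "B_stat (mset_set {1..s} + {#1, 1, 1#}) = 1"
    using assms by ((subst A_stat_mset_set_add, simp, force, subst 1, simp) | (subst B_stat_mset_set_add, simp, force, simp))+
  show "A_stat (mset_set (insert (s + 1) {1..s - 1}) + {#2#}) = 1"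
    "A_stat (mset_set (insert (s + 1) {1..s - 1}) + {#1, 1#}) = 1"
    "A_stat (mset_set (insert (s + 2) {1..s - 1}) + {#1#}) = 1"
    using assms by (subst A_stat_mset_set_add, simp, force, subst 2; simp)+
  show "B_stat (mset_set (insert (s + 1) {1..s - 1}) + {#2#}) = 1"
    "B_stat (mset_set (insert (s + 1) {1..s - 1}) + {#1, 1#}) = 1"
    "B_stat (mset_set (insert (s + 2) {1..s - 1}) + {#1#}) = 1"
    "B_stat (mset_set ({s + 1, s} \<union> {1..s - 2}) + {#1#}) = 1"
    using assms by (subst B_stat_mset_set_add; force)+
  show "A_stat (mset_set ({s + 1, s} \<union> {1..s - 2}) + {#1#}) = 1"
    using assms by (subst A_stat_mset_set_add, simp, force, subst 3; simp)
  show "A_stat (mset_set (insert (s + 3) {1..s - 1})) = 1"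
    by (subst empty, simp, simp, subst 2; simp)
  show "A_stat (mset_set ({s + 2, s} \<union> {1..s - 2})) = 2"
    by (subst empty, simp, simp, subst 4; simp)
  show "A_stat (mset_set ({s + 1, s, s - 1} \<union> {1..s - 3})) = 1"
    by (subst empty, simp, simp, subst 5; simp)
  show "B_stat (mset_set (insert (s + 3) {1..s - 1})) = 0"
    "B_stat (mset_set ({s + 2, s} \<union> {1..s - 2})) = 0"
    "B_stat (mset_set ({s + 1, s, s - 1} \<union> {1..s - 3})) = 0"
    by (subst empty; simp)+
qed


section \<open>The six extremal partitions\<close>

text \<open>The shapes with A + B = 2, ordered by type: one of type (2, 0), four of type (1, 1), one
  of type (0, 2). A list allows the types to be counted with repetition.\<close>

definition top_partitions :: "nat \<Rightarrow> nat multiset list" where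
  "top_partitions s =
    [mset_set ({s + 2, s} \<union> {1..s - 2}),
     mset_set (insert (s + 1) {1..s - 1}) + {#2#},
     mset_set (insert (s + 1) {1..s - 1}) + {#1, 1#},
     mset_set (insert (s + 2) {1..s - 1}) + {#1#},
     mset_set ({s + 1, s} \<union> {1..s - 2}) + {#1#},
     mset_set {1..s} + {#1, 2#}]"

lemma stats_top_partitions:
  assumes "s \<ge> 3"
  shows "map (\<lambda>p. (A_stat p, B_stat p)) (top_partitions s) = [(2, 0), (1, 1), (1, 1), (1, 1), (1, 1), (0, 2)]"
  by (simp only: top_partitions_def list.map stats_max_distinct_parts[OF assms])

lemma A_stat_add_B_stat_max_distinct_parts:
  assumes s: "s \<ge> 3" and p: "p \<in> partitions (tri s + 3)" and card: "card (set_mset p) = s"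
  shows "A_stat p + B_stat p \<le> 2"
    and "A_stat p + B_stat p = 2 \<Longrightarrow> p \<in> set (top_partitions s)"
proof -
  note stats = stats_max_distinct_parts[OF s]
  show "A_stat p + B_stat p \<le> 2"
    by (rule partitions_max_distinct_parts[OF assms]; simp only: stats; simp)
  show "p \<in> set (top_partitions s)" if AB: "A_stat p + B_stat p = 2"
    \<comment> \<open>\<open>AB\<close> refutes the four shapes whose statistics sum to 1.\<close>
    by (rule partitions_max_distinct_parts[OF assms]; insert AB;
        simp only: stats top_partitions_def list.set insert_iff simp_thms; simp?)
qed

lemma tri_diff:
  assumes "s \<ge> 3"
  shows "tri s = tri (s - 1) + s" "tri (s - 1) = tri (s - 2) + (s - 1)"
proof -
  obtain m where "s = Suc (Suc m)" using assms by (metis Suc_le_D numeral_3_eq_3 le_SucE Suc_leD)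
  then show "tri s = tri (s - 1) + s" "tri (s - 1) = tri (s - 2) + (s - 1)" by auto
qed

lemma sum_mset_mset_set: "sum_mset (mset_set D) = \<Sum>D" for D :: "nat set"
  by (simp add: sum_unfold_sum_mset)

lemma top_partitions:
  assumes s: "s \<ge> 3" and p: "p \<in> set (top_partitions s)"
  shows "p \<in> partitions (tri s + 3)" "card (set_mset p) = s"
proof -
  note sums = sum_Icc_eq_tri[unfolded One_nat_def] tri_diff[OF s, unfolded One_nat_def]
  have "(\<forall>x \<in># p. 0 < x) \<and> sum_mset p = tri s + 3"
    using s p by (auto simp: top_partitions_def sum_mset_mset_set sums)
  then show "p \<in> partitions (tri s + 3)" by (simp add: partitions_def)
  show "card (set_mset p) = s"
    using s p by (auto simp: top_partitions_def insert_absorb)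
qed

lemma distinct_top_partitions:
  assumes "s \<ge> 3"
  shows "distinct (top_partitions s)"
proof -
  \<comment> \<open>The membership tests separate all entries except the second and third, which
    \<open>size\<close> tells apart.\<close>
  have "distinct (map (\<lambda>p. (s \<in># p, s - 1 \<in># p, s + 1 \<in># p, s + 2 \<in># p, size p)) (top_partitions s))"
    using assms by (auto simp: top_partitions_def)
  then show ?thesis by (rule distinct_map[THEN iffD1, THEN conjunct1])
qed

text \<open>Used contrapositively: a column length that is not a part of \<open>p\<close> rules out
  \<open>p = conjugate p\<close>.\<close>

lemma columns_in_conjugate:
  assumes "x \<in># p" "1 \<le> j" "j \<le> x"
  shows "size {#y \<in># p. j \<le> y#} \<in># conjugate p"
  using assms finite_conjugate_index[of p] by (auto simp: conjugate_def intro!: imageI)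

lemma not_selfconj_top_partitions:
  assumes s: "s \<ge> 3" and p: "p \<in> set (top_partitions s)"
  shows "p \<noteq> conjugate p"
proof -
  have "\<exists>x \<in># p. 2 \<le> x" using s p by (auto simp: top_partitions_def)
  then obtain x where x: "x \<in># p" "2 \<le> x" by blast
  have filters: "{y. Suc 0 \<le> y \<and> y \<le> m \<and> Suc 0 \<le> y} = {Suc 0..m}"
    "{y. Suc 0 \<le> y \<and> y \<le> m \<and> 2 \<le> y} = {2..m}" for m
    by auto
  \<comment> \<open>The first column length fails for the third, fourth and sixth entries
    (\<open>s + 2\<close>, \<open>s + 1\<close>, \<open>s + 2\<close>); the second column length
    fails for the first, second and fifth (\<open>s - 1\<close>, \<open>s\<close>,
    \<open>s - 1\<close>).\<close>
  have "size {#y \<in># p. 1 \<le> y#} \<notin># p \<or> size {#y \<in># p. 2 \<le> y#} \<notin># p"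
    using s p by (auto simp: top_partitions_def filters)
  with columns_in_conjugate[OF x(1), of 1] columns_in_conjugate[OF x(1), of 2] x(2) show ?thesis by auto
qed

section \<open>The maximizers\<close>

text \<open>More than \<open>s\<close> distinct sizes would need a sum of at least
  \<open>tri (Suc s) = tri s + s + 1\<close>, which exceeds \<open>tri s + 3\<close> because
  \<open>s \<ge> 3\<close>.\<close>

lemma card_distinct_parts_le:
  assumes s: "s \<ge> 3" and p: "p \<in> partitions (tri s + 3)"
  shows "card (set_mset p) \<le> s"
proof (rule ccontr)
  assume "\<not> ?thesis"
  then have "tri (Suc s) \<le> tri (card (set_mset p))" by (intro tri_mono) simp
  also have "\<dots> \<le> \<Sum>(set_mset p)" using zero_notin_partitions[OF p] by (intro tri_card_le_sum) auto
  also have "\<dots> \<le> sum_mset p"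
  proof -
    obtain E where "p = mset_set (set_mset p) + E" by (rule mset_set_add_excess)
    then have "sum_mset p = \<Sum>(set_mset p) + sum_mset E"
      by (metis sum_mset.union sum_mset_mset_set)
    then show ?thesis by simp
  qed
  finally show False using p s by (simp add: partitions_def)
qed

lemma
  assumes s: "s \<ge> 3"
  shows deg_le_top: "p \<in> partitions (tri s + 3) \<Longrightarrow> deg (tri s + 3) p \<le> s * (s - 1) + 2"
    and deg_eq_top_iff: "p \<in> partitions (tri s + 3) \<Longrightarrow>
      deg (tri s + 3) p = s * (s - 1) + 2 \<longleftrightarrow> p \<in> set (top_partitions s)"
proof -
  assume p: "p \<in> partitions (tri s + 3)"
  define r where "r = card (set_mset p)"
  have "r \<le> s" using card_distinct_parts_le[OF s p] by (simp add: r_def)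
  have "deg (tri s + 3) p \<le> s * (s - 1) + 2 \<and>
      (deg (tri s + 3) p = s * (s - 1) + 2 \<longleftrightarrow> p \<in> set (top_partitions s))"
  proof (cases "r = s")
    case True
    have "s * s = s * (s - 1) + s" using s by (cases s) auto
    with deg_add_distinct_parts[OF p] True have deg: "deg (tri s + 3) p = s * (s - 1) + (A_stat p + B_stat p)"
      by (simp add: r_def)
    \<comment> \<open>The converse of the classification, read off from the table of types.\<close>
    have "A_stat p + B_stat p = 2" if "p \<in> set (top_partitions s)"
    proof -
      have "(A_stat p, B_stat p) \<in> set (map (\<lambda>p. (A_stat p, B_stat p)) (top_partitions s))"
        using that by simp
      then show ?thesis unfolding stats_top_partitions[OF s] by auto
    qed
    moreover have "card (set_mset p) = s" using True by (simp add: r_def)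
    note A_stat_add_B_stat_max_distinct_parts[OF s p this]
    ultimately show ?thesis unfolding deg by (metis add_le_cancel_left add_left_cancel)
  next
    case False
    then have "r \<le> s - 1" using \<open>r \<le> s\<close> by simp
    \<comment> \<open>With fewer than \<open>s\<close> sizes even the crude bound stays 2 below the
      claimed maximum.\<close>
    then have "r * (r + 1) \<le> (s - 1) * (s - 1 + 1)" by (intro mult_mono) auto
    also have "\<dots> = s * (s - 1)" using s by simp
    finally have "deg (tri s + 3) p \<le> s * (s - 1)" using deg_le[OF p] by (simp add: r_def)
    moreover have "p \<notin> set (top_partitions s)" using top_partitions(2)[OF s, of p] False by (auto simp: r_def)
    ultimately show ?thesis by auto
  qed
  then show "deg (tri s + 3) p \<le> s * (s - 1) + 2"
    "deg (tri s + 3) p = s * (s - 1) + 2 \<longleftrightarrow> p \<in> set (top_partitions s)" by auto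
qed

lemma maximizers_eq:
  assumes s: "s \<ge> 3"
  shows "maximizers (tri s + 3) = set (top_partitions s)"
proof -
  \<comment> \<open>Any one entry witnesses that the upper bound is attained.\<close>
  obtain p where p: "p \<in> set (top_partitions s)" by (fastforce simp: top_partitions_def)
  have "max_deg (tri s + 3) = s * (s - 1) + 2"
    unfolding max_deg_def
  proof (rule Max_eqI)
    show "finite (deg (tri s + 3) ` partitions (tri s + 3))" by (simp add: finite_partitions)
    show "s * (s - 1) + 2 \<in> deg (tri s + 3) ` partitions (tri s + 3)"
      using deg_eq_top_iff[OF s] top_partitions(1)[OF s p] p by (metis image_eqI)
  qed (use deg_le_top[OF s] in blast)
  then show ?thesis
    using deg_eq_top_iff[OF s] top_partitions(1)[OF s] by (auto simp: maximizers_def)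
qed

theorem proposition7p1:
  fixes s :: nat
  assumes "s \<ge> 3"
  shows "types (tri s + 3) = {(2, 0), (1, 1), (0, 2)}
    \<and> card (maximizers_of_type (tri s + 3) (2, 0)) = 1
    \<and> card (maximizers_of_type (tri s + 3) (1, 1)) = 4
    \<and> card (maximizers_of_type (tri s + 3) (0, 2)) = 1
    \<and> card (maximizers (tri s + 3)) = 6
    \<and> num_selfconj_maximizers (tri s + 3) = 0"
proof -
  note max = maximizers_eq[OF assms]
  define f where "f p = (A_stat p, B_stat p)" for p
  have f: "map f (top_partitions s) = [(2, 0), (1, 1), (1, 1), (1, 1), (1, 1), (0, 2)]"
    using stats_top_partitions[OF assms] by (simp add: f_def[abs_def])
  have "types (tri s + 3) = set (map f (top_partitions s))"
    unfolding types_def max f_def set_map ..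
  then have "types (tri s + 3) = {(2, 0), (1, 1), (0, 2)}" unfolding f by auto
  \<comment> \<open>As the list has no repetitions, the size of a type class is the number of times
    its type occurs in the list of types.\<close>
  moreover have "card (maximizers_of_type (tri s + 3) t) = count_list (map f (top_partitions s)) t" for t
  proof -
    have "maximizers_of_type (tri s + 3) t = set (filter (\<lambda>p. t = f p) (top_partitions s))"
      unfolding maximizers_of_type_def max f_def by auto
    also have "card \<dots> = length (filter (\<lambda>p. t = f p) (top_partitions s))"
      by (intro distinct_card distinct_filter distinct_top_partitions[OF assms])
    also have "\<dots> = count_list (map f (top_partitions s)) t"
      by (simp add: count_list_eq_length_filter filter_map comp_def)
    finally show ?thesis .
  qed
  moreover have "count_list (map f (top_partitions s)) (2, 0) = 1"
    "count_list (map f (top_partitions s)) (1, 1) = 4"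
    "count_list (map f (top_partitions s)) (0, 2) = 1"
    unfolding f by simp_all
  moreover have "card (maximizers (tri s + 3)) = length (top_partitions s)"
    unfolding max by (rule distinct_card[OF distinct_top_partitions[OF assms]])
  moreover have "{p \<in> set (top_partitions s). p = conjugate p} = {}"
    using not_selfconj_top_partitions[OF assms] by blast
  then have "num_selfconj_maximizers (tri s + 3) = 0"
    unfolding num_selfconj_maximizers_def max by (simp only: card.empty)
  moreover have "length (top_partitions s) = 6" by (simp add: top_partitions_def)
  ultimately show ?thesis by simp
qed

end
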